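(* Let $(\mathcal{X},\rho_{\rm x})$ and $(\mathcal{Y},\rho_{\rm y})$ be finite-dimensional complete metric spaces, let $f:\mathcal{X}\to\mathcal{X}$ and $h:\mathcal{X}\to\mathcal{Y}$ be uniformly continuous, and consider the system $$x_{k+1}=f(x_k),\qquad y_k=h(x_k),\qquad k\in\mathbb{N}.$$ Let $\ell:\mathcal{Y}\times\mathcal{Y}\to\mathbb{R}_{\geq 0}$ be symmetric, i.e., $\ell(v,w)=\ell(w,v)$, and let $\alpha_1,\alpha_2\in\mathcal{K}_\infty$ satisfy $$\alpha_1(\rho_{\rm y}(v,w))\leq \ell(v,w)\leq\alpha_2(\rho_{\rm y}(v,w))\quad\text{for all } v,w\in\mathcal{Y}.$$ Let $N\geq 1$ be an integer and define $J:\mathcal{X}\times\mathcal{X}\times\mathcal{Y}\to\mathbb{R}_{\geq 0}$ by $$J(\xi,z,y):=\ell(h(f^{N-1}(\xi)),y)+\sum_{i=0}^{N-2}\ell(h(f^{i}(\xi)),h(f^{i}(z))).$$ Suppose that the following two conditions hold. 1. There exists $\alpha_3\in\mathcal{K}_\infty$ such that for all $z,\tilde x\in\mathcal{X}$ $$\sum_{i=0}^{N-1}\ell(h(f^{i}(z)),h(f^{i}(\tilde x)))\geq\alpha_3(\rho_{\rm x}(z,\tilde x)).$$ 2. There exists $\eta:\mathcal{X}\times\mathcal{Y}\to\mathcal{X}$ such that $J(\eta(z,y),z,y)<J(\xi,z,y)$ for all $z\in\mathcal{X}$, $y\in\mathcal{Y}$ and all $\xi\neq\eta(z,y)$ in $\mathcal{X}$.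 Moreover, there exists $\alpha_4\in\mathcal{K}_\infty$ such that for all $z,\tilde x\in\mathcal{X}$, with $\eta=\eta(z,h(f^{N-1}(\tilde x)))$, $$\alpha_4\big(J(\eta,z,h(f^{N-1}(\tilde x)))\big)+\sum_{i=0}^{N-1}\ell(h(f^{i}(\eta)),h(f^{i}(\tilde x)))\leq\sum_{i=0}^{N-2}\ell(h(f^{i}(z)),h(f^{i}(\tilde x))).$$ Consider the observer $$z_{k+1}=f(\eta(z_k,y_k)),\qquad \hat x_k=f^{N-1}(z_k),\qquad k\in\mathbb{N},$$ where $\eta(z,y)=\arg\min_{\xi\in\mathcal{X}}J(\xi,z,y)$. Then for each $\varepsilon>0$ there exists $\delta>0$ such that, for all initial conditions $x_0,z_0\in\mathcal{X}$, $\rho_{\rm x}(\hat x_0,x_0)\leq\delta$ implies $\rho_{\rm x}(\hat x_k,x_k)\leq\varepsilon$ for all $k\in\mathbb{N}$. Moreover, for all initial conditions $x_0,z_0\in\mathcal{X}$, $\rho_{\rm x}(\hat x_k,x_k)\to 0$ as $k\to\infty$.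
   Context: $\mathbb{N}$ denotes the nonnegative integers and $\mathbb{R}_{\geq 0}$ the nonnegative reals. For a mapping $f:\mathcal{X}\to\mathcal{X}$, $f^{0}(x)=x$ and $f^{k+1}(x)=f(f^{k}(x))$. A function $\alpha:\mathbb{R}_{\geq 0}\to\mathbb{R}_{\geq 0}$ belongs to class $\mathcal{K}_\infty$ if it is continuous, zero at zero, strictly increasing, and unbounded. An empty sum is zero. *)

theory Defs
  imports "HOL-Analysis.Analysis"
begin

definition class_K_inf :: "(real \<Rightarrow> real) \<Rightarrow> bool" where
  "class_K_inf \<alpha> \<longleftrightarrow>
     \<alpha> \<in> {0..} \<rightarrow> {0..} \<and> continuous_on {0..} \<alpha> \<and> \<alpha> 0 = 0 \<and>
     strict_mono_on {0..} \<alpha> \<and> \<not> bounded (\<alpha> ` {0..})"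

text \<open>
  Finiteness of the small inductive dimension. It is bounded by the covering dimension of a
  metric space and by its Hausdorff dimension, so this is the most permissive of the usual
  readings of a finite-dimensional metric space.
\<close>

definition finite_dimensional_space :: "'a topology \<Rightarrow> bool" where
  "finite_dimensional_space X \<longleftrightarrow> (\<exists>n. X dim_le n)"

text \<open>
  The horizon length satisfies \<open>N \<ge> 1\<close> wherever this is used; \<open>{..<N - 1}\<close> is then the index
  range from \<open>0\<close> to \<open>N - 2\<close>, which is empty for \<open>N = 1\<close>.
\<close>

definition horizon_cost ::
  "('a \<Rightarrow> 'a) \<Rightarrow> ('a \<Rightarrow> 'b) \<Rightarrow> ('b \<Rightarrow> 'b \<Rightarrow> real) \<Rightarrow> nat \<Rightarrow> 'a \<Rightarrow> 'a \<Rightarrow> 'b \<Rightarrow> real" where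
  "horizon_cost f h l N \<xi> z y =
     l (h ((f ^^ (N - 1)) \<xi>)) y + (\<Sum>i<N - 1. l (h ((f ^^ i) \<xi>)) (h ((f ^^ i) z)))"

definition system_run ::
  "('a \<Rightarrow> 'a) \<Rightarrow> ('a \<Rightarrow> 'b) \<Rightarrow> (nat \<Rightarrow> 'a) \<Rightarrow> (nat \<Rightarrow> 'b) \<Rightarrow> bool" where
  "system_run f h x y \<longleftrightarrow> (\<forall>k. x (Suc k) = f (x k) \<and> y k = h (x k))"

definition observer_run ::
  "('a \<Rightarrow> 'a) \<Rightarrow> ('a \<Rightarrow> 'b) \<Rightarrow> ('b \<Rightarrow> 'b \<Rightarrow> real) \<Rightarrow> nat \<Rightarrow>
    (nat \<Rightarrow> 'b) \<Rightarrow> (nat \<Rightarrow> 'a) \<Rightarrow> (nat \<Rightarrow> 'a) \<Rightarrow> bool" where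
  "observer_run f h l N y z xhat \<longleftrightarrow>
     (\<forall>k. z (Suc k) = f (ARG_MIN (\<lambda>\<xi>. horizon_cost f h l N \<xi> (z k) (y k)) \<xi>. True) \<and>
          xhat k = (f ^^ (N - 1)) (z k))"

end

theory Submission
  imports Defs
begin

text \<open>
  At time \<open>k + (N - 1)\<close> the observer state \<open>z\<close> is compared with the delayed plant state \<open>x k\<close>, from
  which the output \<open>y (k + (N - 1)) = h ((f ^^ (N - 1)) (x k))\<close> stems. Let \<open>e\<close> be the minimizer computed
  from \<open>z\<close> and this output, so that \<open>f e\<close> is the next observer state. The output mismatch
  \<open>V k = (\<Sum>i<N - 1. l (h ((f ^^ i) z)) (h ((f ^^ i) (x k))))\<close> is a Lyapunov function: shifting the sum
  by one step turns the decrease condition into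
  \<open>V (k + 1) + l (h e) (h (x k)) + \<alpha>4 (J e) \<le> V k\<close> (\<open>mismatch_descent\<close>).

  Convergence (\<open>corrected_merges_with_plant\<close>): as \<open>V\<close> is nonincreasing and bounded below, both
  \<open>l (h e) (h (x k))\<close> and the optimal cost \<open>J e\<close> tend to zero. A vanishing optimal cost means that
  outputs predicted from \<open>e\<close> merge with those predicted from \<open>z\<close>. Since \<open>z\<close> at the next time is \<open>f e\<close>,
  knowing that \<open>h ((f ^^ i) e)\<close> merges with \<open>h ((f ^^ i) (x k))\<close> gives the same for \<open>i + 1\<close>. Thus all
  \<open>N\<close> outputs merge, and observability gives that \<open>e\<close> merges with \<open>x k\<close>.

  Stability: the decrease condition and observability bound the distance of \<open>e\<close> and \<open>x k\<close> in terms of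
  \<open>V 0\<close>, uniformly in \<open>k\<close>. What remains is that \<open>V 0\<close>, which belongs to time \<open>N - 1\<close>, and the errors
  before that time are small. There the decrease condition says nothing, because the outputs
  received so far need not come from a state \<open>N - 1\<close> steps in the past; the initial plant state
  may lie outside the range of \<open>f ^^ (N - 1)\<close>. Instead, if \<open>z\<close> predicts the current output almost
  correctly, then \<open>z\<close> itself is a candidate with small cost; the minimizer then has small cost too
  and, by observability, lies close to \<open>z\<close> (\<open>small_correction\<close>). Hence over finitely many steps the
  observer almost follows the open-loop prediction (\<open>est_merges_with_open_loop\<close>).

  All these arguments only use that one quantity is small when another one is, uniformly in the
  state. They are phrased as limits along a filter \<open>F\<close>: the sequence filter on time for convergence,
  the filter of initial conditions with vanishing error for the first steps, and the product of
  the latter with the trivial filter on time for bounds uniform in time.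
\<close>

section \<open>Merging families in metric spaces\<close>

lemma tendsto_0_le:
  fixes u v :: "'i \<Rightarrow> real"
  assumes "(v \<longlongrightarrow> 0) F" "\<And>i. 0 \<le> u i" "\<And>i. u i \<le> v i"
  shows "(u \<longlongrightarrow> 0) F"
  by (rule tendsto_sandwich[OF _ _ tendsto_const assms(1)]) (use assms in auto)

definition merging ::
  "'i filter \<Rightarrow> ('i \<Rightarrow> 'a::metric_space) \<Rightarrow> ('i \<Rightarrow> 'a) \<Rightarrow> bool" where
  "merging F a b \<longleftrightarrow> ((\<lambda>i. dist (a i) (b i)) \<longlongrightarrow> 0) F"

lemma merging_refl: "merging F a a"
  by (simp add: merging_def)

lemma merging_sym: "merging F a b \<Longrightarrow> merging F b a"
  by (simp add: merging_def dist_commute)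

lemma merging_trans [trans]:
  assumes "merging F a b" "merging F b c"
  shows "merging F a c"
  unfolding merging_def
proof (rule tendsto_0_le)
  show "((\<lambda>i. dist (a i) (b i) + dist (b i) (c i)) \<longlongrightarrow> 0) F"
    using tendsto_add[OF assms[unfolded merging_def]] by simp
qed (simp_all add: dist_triangle)

lemma merging_iff:
  "merging F a b \<longleftrightarrow> (\<forall>\<epsilon>>0. \<forall>\<^sub>F i in F. dist (a i) (b i) < \<epsilon>)"
  by (simp add: merging_def tendsto_iff)

lemma merging_compose:
  assumes "merging G a b" "filterlim g G F"
  shows "merging F (\<lambda>i. a (g i)) (\<lambda>i. b (g i))"
  using filterlim_compose[OF assms(1)[unfolded merging_def] assms(2)] by (simp add: merging_def)

lemma merging_uniformly_continuous:
  assumes "uniformly_continuous_on UNIV f" "merging F a b"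
  shows "merging F (\<lambda>i. f (a i)) (\<lambda>i. f (b i))"
  unfolding merging_iff
proof (intro allI impI)
  fix \<epsilon> :: real assume "\<epsilon> > 0"
  with assms(1) obtain d where "d > 0" and d: "\<And>u v. dist u v < d \<Longrightarrow> dist (f u) (f v) < \<epsilon>"
    unfolding uniformly_continuous_on_def by (metis UNIV_I)
  from assms(2) \<open>d > 0\<close> have "\<forall>\<^sub>F i in F. dist (a i) (b i) < d"
    by (simp add: merging_iff)
  then show "\<forall>\<^sub>F i in F. dist (f (a i)) (f (b i)) < \<epsilon>"
    by eventually_elim (rule d)
qed

lemma funpow_plus: "(f ^^ (m + n)) x = (f ^^ m) ((f ^^ n) x)"
  by (simp add: funpow_add)

lemma funpow_commute: "(f ^^ m) ((f ^^ n) x) = (f ^^ n) ((f ^^ m) x)"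
  by (metis add.commute funpow_plus)

lemma merging_funpow:
  fixes f :: "'a::metric_space \<Rightarrow> 'a"
  assumes "uniformly_continuous_on UNIV f" "merging F a b"
  shows "merging F (\<lambda>i. (f ^^ n) (a i)) (\<lambda>i. (f ^^ n) (b i))"
  by (induction n) (simp_all add: assms(2) merging_uniformly_continuous[OF assms(1)])

lemma tendsto_0_sum_iff:
  fixes u :: "'j \<Rightarrow> 'i \<Rightarrow> real"
  assumes "finite A" "\<And>j i. 0 \<le> u j i"
  shows "((\<lambda>i. \<Sum>j\<in>A. u j i) \<longlongrightarrow> 0) F \<longleftrightarrow> (\<forall>j\<in>A. (u j \<longlongrightarrow> 0) F)"
proof
  assume lim: "((\<lambda>i. \<Sum>j\<in>A. u j i) \<longlongrightarrow> 0) F"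
  show "\<forall>j\<in>A. (u j \<longlongrightarrow> 0) F"
  proof
    fix j assume "j \<in> A"
    then have "u j i \<le> (\<Sum>j\<in>A. u j i)" for i
      using member_le_sum[of j A "\<lambda>j. u j i"] assms by simp
    then show "(u j \<longlongrightarrow> 0) F"
      by (rule tendsto_0_le[OF lim assms(2)])
  qed
next
  assume "\<forall>j\<in>A. (u j \<longlongrightarrow> 0) F"
  then show "((\<lambda>i. \<Sum>j\<in>A. u j i) \<longlongrightarrow> 0) F"
    by (intro tendsto_null_sum) blast
qed

section \<open>Comparison functions\<close>

lemma class_K_inf_nonneg: "class_K_inf \<alpha> \<Longrightarrow> 0 \<le> t \<Longrightarrow> 0 \<le> \<alpha> t"
  by (auto simp: class_K_inf_def Pi_iff)

lemma class_K_inf_tendsto_0_iff: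
  assumes \<alpha>: "class_K_inf \<alpha>" and nonneg: "\<And>i. 0 \<le> u i"
  shows "((\<lambda>i. \<alpha> (u i)) \<longlongrightarrow> 0) F \<longleftrightarrow> (u \<longlongrightarrow> 0) F"
proof
  assume lim: "(u \<longlongrightarrow> 0) F"
  have "continuous_on {0..} \<alpha>"
    using \<alpha> by (simp add: class_K_inf_def)
  from continuous_on_tendsto_compose[OF this lim]
  have "((\<lambda>i. \<alpha> (u i)) \<longlongrightarrow> \<alpha> 0) F"
    using nonneg by simp
  then show "((\<lambda>i. \<alpha> (u i)) \<longlongrightarrow> 0) F"
    using \<alpha> by (simp add: class_K_inf_def)
next
  assume lim: "((\<lambda>i. \<alpha> (u i)) \<longlongrightarrow> 0) F"
  have mono: "strict_mono_on {0..} \<alpha>" and "\<alpha> 0 = 0"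
    using \<alpha> by (auto simp: class_K_inf_def)
  show "(u \<longlongrightarrow> 0) F"
  proof (rule order_tendstoI)
    fix \<epsilon> :: real assume "0 < \<epsilon>"
    then have "0 < \<alpha> \<epsilon>"
      using strict_mono_onD[OF mono, of 0 \<epsilon>] \<open>\<alpha> 0 = 0\<close> by simp
    with lim have "\<forall>\<^sub>F i in F. \<alpha> (u i) < \<alpha> \<epsilon>"
      by (rule order_tendstoD)
    then show "\<forall>\<^sub>F i in F. u i < \<epsilon>"
    proof (rule eventually_mono)
      fix i
      assume "\<alpha> (u i) < \<alpha> \<epsilon>"
      then show "u i < \<epsilon>"
        using strict_mono_on_less[OF mono, of "u i" \<epsilon>] nonneg[of i] \<open>0 < \<epsilon>\<close> by simp
    qed
  next
    fix a :: real assume "a < 0"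
    then show "\<forall>\<^sub>F i in F. a < u i"
      using nonneg by (simp add: less_le_trans)
  qed
qed

section \<open>The observer\<close>

locale moving_horizon_observer =
  fixes f :: "'a::metric_space \<Rightarrow> 'a"
    and h :: "'a \<Rightarrow> 'b::metric_space"
    and l :: "'b \<Rightarrow> 'b \<Rightarrow> real"
    and \<alpha>1 \<alpha>2 \<alpha>3 \<alpha>4 :: "real \<Rightarrow> real"
    and N :: nat
    and \<eta> :: "'a \<Rightarrow> 'b \<Rightarrow> 'a"
  assumes uc_f: "uniformly_continuous_on UNIV f"
    and uc_h: "uniformly_continuous_on UNIV h"
    and l_nonneg: "0 \<le> l v w"
    and K1: "class_K_inf \<alpha>1" and K2: "class_K_inf \<alpha>2"
    and K3: "class_K_inf \<alpha>3" and K4: "class_K_inf \<alpha>4"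
    and l_lower: "\<alpha>1 (dist v w) \<le> l v w"
    and l_upper: "l v w \<le> \<alpha>2 (dist v w)"
    and N_pos: "1 \<le> N"
    and observability: "\<alpha>3 (dist z x) \<le> (\<Sum>i<N. l (h ((f ^^ i) z)) (h ((f ^^ i) x)))"
    and minimal: "horizon_cost f h l N (\<eta> z y) z y \<le> horizon_cost f h l N \<xi> z y"
    and decrease:
      "\<alpha>4 (horizon_cost f h l N (\<eta> z (h ((f ^^ (N - 1)) x))) z (h ((f ^^ (N - 1)) x)))
         + (\<Sum>i<N. l (h ((f ^^ i) (\<eta> z (h ((f ^^ (N - 1)) x))))) (h ((f ^^ i) x)))
       \<le> (\<Sum>i<N - 1. l (h ((f ^^ i) z)) (h ((f ^^ i) x)))"
begin

definition mismatch :: "nat \<Rightarrow> 'a \<Rightarrow> 'a \<Rightarrow> real" where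
  "mismatch n z x = (\<Sum>i<n. l (h ((f ^^ i) z)) (h ((f ^^ i) x)))"

primrec est :: "'a \<Rightarrow> 'a \<Rightarrow> nat \<Rightarrow> 'a" where
  "est x0 z0 0 = z0"
| "est x0 z0 (Suc k) = f (\<eta> (est x0 z0 k) (h ((f ^^ k) x0)))"

definition corrected :: "'a \<Rightarrow> 'a \<Rightarrow> nat \<Rightarrow> 'a" where
  "corrected x0 z0 k = \<eta> (est x0 z0 k) (h ((f ^^ k) x0))"

lemma est_Suc: "est x0 z0 (Suc k) = f (corrected x0 z0 k)"
  by (simp add: corrected_def)

lemma mismatch_nonneg: "0 \<le> mismatch n z x"
  by (simp add: mismatch_def sum_nonneg l_nonneg)

lemma cost_nonneg: "0 \<le> horizon_cost f h l N \<xi> z y"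
  by (simp add: horizon_cost_def sum_nonneg l_nonneg)

lemma l_tendsto_0_iff: "((\<lambda>i. l (v i) (w i)) \<longlongrightarrow> 0) F \<longleftrightarrow> merging F v w"
proof
  assume "((\<lambda>i. l (v i) (w i)) \<longlongrightarrow> 0) F"
  then have "((\<lambda>i. \<alpha>1 (dist (v i) (w i))) \<longlongrightarrow> 0) F"
    by (rule tendsto_0_le) (auto intro: class_K_inf_nonneg[OF K1] l_lower)
  then show "merging F v w"
    by (simp add: class_K_inf_tendsto_0_iff[OF K1] merging_def)
next
  assume "merging F v w"
  then have "((\<lambda>i. \<alpha>2 (dist (v i) (w i))) \<longlongrightarrow> 0) F"
    by (simp add: class_K_inf_tendsto_0_iff[OF K2] merging_def)
  then show "((\<lambda>i. l (v i) (w i)) \<longlongrightarrow> 0) F"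
    by (rule tendsto_0_le) (auto intro: l_nonneg l_upper)
qed

lemma mismatch_tendsto_0_iff:
  "((\<lambda>i. mismatch n (a i) (b i)) \<longlongrightarrow> 0) F \<longleftrightarrow>
     (\<forall>j<n. merging F (\<lambda>i. h ((f ^^ j) (a i))) (\<lambda>i. h ((f ^^ j) (b i))))"
  unfolding mismatch_def
  by (subst tendsto_0_sum_iff) (auto simp: l_nonneg l_tendsto_0_iff)

lemma cost_tendsto_0_iff:
  "((\<lambda>i. horizon_cost f h l N (a i) (b i) (y i)) \<longlongrightarrow> 0) F \<longleftrightarrow>
     merging F (\<lambda>i. h ((f ^^ (N - 1)) (a i))) y \<and>
     (\<forall>j<N - 1. merging F (\<lambda>i. h ((f ^^ j) (a i))) (\<lambda>i. h ((f ^^ j) (b i))))"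
proof -
  have cost: "horizon_cost f h l N (a i) (b i) (y i) =
      l (h ((f ^^ (N - 1)) (a i))) (y i) + mismatch (N - 1) (a i) (b i)" for i
    by (simp add: horizon_cost_def mismatch_def)
  have "((\<lambda>i. horizon_cost f h l N (a i) (b i) (y i)) \<longlongrightarrow> 0) F \<longleftrightarrow>
      ((\<lambda>i. l (h ((f ^^ (N - 1)) (a i))) (y i)) \<longlongrightarrow> 0) F \<and>
      ((\<lambda>i. mismatch (N - 1) (a i) (b i)) \<longlongrightarrow> 0) F" (is "?c \<longleftrightarrow> ?l \<and> ?m")
  proof
    assume ?c
    then show "?l \<and> ?m"
      using l_nonneg mismatch_nonneg
      by (auto intro!: tendsto_0_le[OF \<open>?c\<close>] simp: cost)
  next
    assume "?l \<and> ?m"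
    then show ?c
      unfolding cost by (auto intro: tendsto_add_zero)
  qed
  then show ?thesis
    by (simp only: l_tendsto_0_iff mismatch_tendsto_0_iff)
qed

lemma merging_outputs:
  assumes "merging F a b"
  shows "merging F (\<lambda>i. h ((f ^^ j) (a i))) (\<lambda>i. h ((f ^^ j) (b i)))"
  by (intro merging_uniformly_continuous[OF uc_h] merging_funpow[OF uc_f] assms)

lemma merging_by_observability:
  assumes "\<And>j. j < N \<Longrightarrow> merging F (\<lambda>i. h ((f ^^ j) (a i))) (\<lambda>i. h ((f ^^ j) (b i)))"
  shows "merging F a b"
proof -
  have "((\<lambda>i. mismatch N (a i) (b i)) \<longlongrightarrow> 0) F"
    using assms by (simp add: mismatch_tendsto_0_iff)
  then have "((\<lambda>i. \<alpha>3 (dist (a i) (b i))) \<longlongrightarrow> 0) F"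
    by (rule tendsto_0_le) (auto intro: class_K_inf_nonneg[OF K3] observability simp: mismatch_def)
  then show ?thesis
    by (simp add: class_K_inf_tendsto_0_iff[OF K3] merging_def)
qed

section \<open>The first steps\<close>

text \<open>
  The candidate \<open>\<xi> = z\<close> has small cost, hence so has the minimizer. Its outputs are then
  close to those of \<open>z\<close>, the last one by way of the measurement.
\<close>

lemma small_correction:
  assumes "merging F (\<lambda>i. h ((f ^^ (N - 1)) (z i))) y"
  shows "merging F (\<lambda>i. \<eta> (z i) (y i)) z"
proof -
  have "((\<lambda>i. horizon_cost f h l N (z i) (z i) (y i)) \<longlongrightarrow> 0) F"
    using assms by (simp add: cost_tendsto_0_iff merging_refl)
  then have "((\<lambda>i. horizon_cost f h l N (\<eta> (z i) (y i)) (z i) (y i)) \<longlongrightarrow> 0) F"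
    by (rule tendsto_0_le) (auto intro: cost_nonneg minimal)
  then have last: "merging F (\<lambda>i. h ((f ^^ (N - 1)) (\<eta> (z i) (y i)))) y"
    and init: "\<forall>j<N - 1. merging F (\<lambda>i. h ((f ^^ j) (\<eta> (z i) (y i)))) (\<lambda>i. h ((f ^^ j) (z i)))"
    unfolding cost_tendsto_0_iff by blast+
  show ?thesis
  proof (rule merging_by_observability)
    fix j assume "j < N"
    then consider "j < N - 1" | "j = N - 1"
      by linarith
    then show "merging F (\<lambda>i. h ((f ^^ j) (\<eta> (z i) (y i)))) (\<lambda>i. h ((f ^^ j) (z i)))"
    proof cases
      case 1
      then show ?thesis using init by blast
    next
      case 2
      then show ?thesis using merging_trans[OF last merging_sym[OF assms]] by simp
    qed
  qed
qed

text \<open>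
  A corrected state close to the observer state keeps the observer close to the free motion from
  \<open>z0\<close>, and only the prediction \<open>(f ^^ (N - 1)) z0\<close> has to be close to the plant state for that. The
  error may grow with \<open>k\<close>, so this serves a fixed number of steps only.
\<close>

lemma est_merges_with_open_loop:
  assumes init: "merging F (\<lambda>i. (f ^^ (N - 1)) (z0 i)) x0"
  shows "merging F (\<lambda>i. est (x0 i) (z0 i) k) (\<lambda>i. (f ^^ k) (z0 i))"
    and "merging F (\<lambda>i. (f ^^ (N - 1)) (est (x0 i) (z0 i) k)) (\<lambda>i. (f ^^ k) (x0 i))"
proof -
  have prediction: "merging F (\<lambda>i. (f ^^ (N - 1)) (est (x0 i) (z0 i) k)) (\<lambda>i. (f ^^ k) (x0 i))"
    if "merging F (\<lambda>i. est (x0 i) (z0 i) k) (\<lambda>i. (f ^^ k) (z0 i))" for k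
  proof -
    have "merging F (\<lambda>i. (f ^^ (N - 1)) (est (x0 i) (z0 i) k))
        (\<lambda>i. (f ^^ (N - 1)) ((f ^^ k) (z0 i)))"
      by (rule merging_funpow[OF uc_f that])
    also have "(\<lambda>i. (f ^^ (N - 1)) ((f ^^ k) (z0 i))) = (\<lambda>i. (f ^^ k) ((f ^^ (N - 1)) (z0 i)))"
      by (intro ext funpow_commute)
    also have "merging F \<dots> (\<lambda>i. (f ^^ k) (x0 i))"
      by (rule merging_funpow[OF uc_f init])
    finally show ?thesis .
  qed
  have follow: "merging F (\<lambda>i. est (x0 i) (z0 i) k) (\<lambda>i. (f ^^ k) (z0 i))" for k
  proof (induction k)
    case 0
    show ?case by (simp add: merging_refl)
  next
    case (Suc k)
    have "merging F (\<lambda>i. \<eta> (est (x0 i) (z0 i) k) (h ((f ^^ k) (x0 i))))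
        (\<lambda>i. est (x0 i) (z0 i) k)"
      by (intro small_correction merging_uniformly_continuous[OF uc_h] prediction Suc)
    also note Suc
    finally show ?case
      using merging_uniformly_continuous[OF uc_f] by simp
  qed
  show "merging F (\<lambda>i. est (x0 i) (z0 i) k) (\<lambda>i. (f ^^ k) (z0 i))"
    and "merging F (\<lambda>i. (f ^^ (N - 1)) (est (x0 i) (z0 i) k)) (\<lambda>i. (f ^^ k) (x0 i))"
    using follow prediction by auto
qed

section \<open>The Lyapunov function and convergence\<close>

text \<open>
  The observer state is compared with the plant state \<open>N - 1\<close> steps earlier, since the measurement it
  meets next is the last one of the window of \<open>N\<close> outputs starting there.
\<close>

definition lyapunov :: "'a \<Rightarrow> 'a \<Rightarrow> nat \<Rightarrow> real" where
  "lyapunov x0 z0 k = mismatch (N - 1) (est x0 z0 (k + (N - 1))) ((f ^^ k) x0)"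

definition optimal_cost :: "'a \<Rightarrow> 'a \<Rightarrow> nat \<Rightarrow> real" where
  "optimal_cost x0 z0 k =
     horizon_cost f h l N (corrected x0 z0 k) (est x0 z0 k) (h ((f ^^ k) x0))"

lemma mismatch_shift: "mismatch N z x = l (h z) (h x) + mismatch (N - 1) (f z) (f x)"
proof -
  obtain M where "N = Suc M"
    using N_pos by (cases N) auto
  then show ?thesis
    by (simp add: mismatch_def sum.lessThan_Suc_shift funpow_Suc_right
        del: sum.lessThan_Suc funpow.simps(2))
qed

lemma corrected_mismatch_le:
  "\<alpha>4 (optimal_cost x0 z0 (k + (N - 1)))
     + mismatch N (corrected x0 z0 (k + (N - 1))) ((f ^^ k) x0) \<le> lyapunov x0 z0 k"
proof -
  have "(f ^^ (k + (N - 1))) x0 = (f ^^ (N - 1)) ((f ^^ k) x0)"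
    by (subst add.commute) (rule funpow_plus)
  then show ?thesis
    using decrease[of "est x0 z0 (k + (N - 1))" "(f ^^ k) x0"]
    by (simp add: optimal_cost_def corrected_def lyapunov_def mismatch_def)
qed

lemma mismatch_descent:
  "lyapunov x0 z0 (Suc k) + l (h (corrected x0 z0 (k + (N - 1)))) (h ((f ^^ k) x0))
     + \<alpha>4 (optimal_cost x0 z0 (k + (N - 1))) \<le> lyapunov x0 z0 k"
  using corrected_mismatch_le[of x0 z0 k]
  by (simp add: mismatch_shift lyapunov_def est_Suc del: est.simps)

lemma optimal_cost_nonneg: "0 \<le> \<alpha>4 (optimal_cost x0 z0 k)"
  by (simp add: optimal_cost_def class_K_inf_nonneg[OF K4] cost_nonneg)

lemma lyapunov_decreasing: "decseq (lyapunov x0 z0)"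
proof (rule decseq_SucI)
  fix k
  show "lyapunov x0 z0 (Suc k) \<le> lyapunov x0 z0 k"
    using mismatch_descent[of x0 z0 k] optimal_cost_nonneg[of x0 z0 "k + (N - 1)"]
      l_nonneg[of "h (corrected x0 z0 (k + (N - 1)))" "h ((f ^^ k) x0)"] by linarith
qed

lemma prediction_after_correction:
  "(f ^^ (N - 1)) (est x0 z0 (k + N)) = (f ^^ N) (corrected x0 z0 (k + (N - 1)))"
proof -
  obtain M where "N = Suc M"
    using N_pos by (cases N) auto
  then show ?thesis
    by (simp add: est_Suc funpow_Suc_right del: est.simps funpow.simps(2))
qed

lemma prediction_merges:
  assumes "merging F (\<lambda>i. corrected (x0 i) (z0 i) (k i + (N - 1))) (\<lambda>i. (f ^^ k i) (x0 i))"
  shows "merging F (\<lambda>i. (f ^^ (N - 1)) (est (x0 i) (z0 i) (k i + N))) (\<lambda>i. (f ^^ (k i + N)) (x0 i))"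
proof -
  have "(f ^^ (k i + N)) (x0 i) = (f ^^ N) ((f ^^ k i) (x0 i))" for i
    by (subst add.commute) (rule funpow_plus)
  then show ?thesis
    using merging_funpow[OF uc_f assms, of N] by (simp only: prediction_after_correction)
qed

text \<open>
  Consecutive differences of the convergent Lyapunov sequence vanish, and they dominate both
  the first output error and the optimal cost.
\<close>

lemma descent_terms_vanish:
  "(\<lambda>k. l (h (corrected x0 z0 (k + (N - 1)))) (h ((f ^^ k) x0))) \<longlonglongrightarrow> 0"
  "(\<lambda>k. optimal_cost x0 z0 (k + (N - 1))) \<longlonglongrightarrow> 0"
proof -
  have "0 \<le> lyapunov x0 z0 k" for k
    by (simp add: lyapunov_def mismatch_nonneg)
  then obtain L where L: "lyapunov x0 z0 \<longlonglongrightarrow> L"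
    using decseq_convergent[OF lyapunov_decreasing] by metis
  have diff: "(\<lambda>k. lyapunov x0 z0 k - lyapunov x0 z0 (Suc k)) \<longlonglongrightarrow> 0"
    using tendsto_diff[OF L LIMSEQ_Suc[OF L]] by simp
  have bounds: "l (h (corrected x0 z0 (k + (N - 1)))) (h ((f ^^ k) x0))
        \<le> lyapunov x0 z0 k - lyapunov x0 z0 (Suc k)"
      "\<alpha>4 (optimal_cost x0 z0 (k + (N - 1))) \<le> lyapunov x0 z0 k - lyapunov x0 z0 (Suc k)" for k
    using mismatch_descent[of x0 z0 k] optimal_cost_nonneg[of x0 z0 "k + (N - 1)"]
      l_nonneg[of "h (corrected x0 z0 (k + (N - 1)))" "h ((f ^^ k) x0)"] by linarith+
  show "(\<lambda>k. l (h (corrected x0 z0 (k + (N - 1)))) (h ((f ^^ k) x0))) \<longlonglongrightarrow> 0"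
    by (rule tendsto_0_le[OF diff l_nonneg bounds(1)])
  have "(\<lambda>k. \<alpha>4 (optimal_cost x0 z0 (k + (N - 1)))) \<longlonglongrightarrow> 0"
    by (rule tendsto_0_le[OF diff optimal_cost_nonneg bounds(2)])
  then show "(\<lambda>k. optimal_cost x0 z0 (k + (N - 1))) \<longlonglongrightarrow> 0"
    by (simp add: class_K_inf_tendsto_0_iff[OF K4] optimal_cost_def cost_nonneg)
qed

text \<open>
  The induction trades time for output index: output \<open>j + 1\<close> of the minimizer at time \<open>k\<close> is output
  \<open>j\<close> of the observer state at time \<open>k + 1\<close>, and the vanishing optimal cost replaces that state by
  the next minimizer, for which output \<open>j\<close> is already treated.
\<close>

lemma corrected_merges_with_plant:
  "merging sequentially (\<lambda>k. corrected x0 z0 (k + (N - 1))) (\<lambda>k. (f ^^ k) x0)"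
proof (rule merging_by_observability)
  have "\<forall>j<N - 1. merging sequentially
      (\<lambda>k. h ((f ^^ j) (corrected x0 z0 (k + (N - 1)))))
      (\<lambda>k. h ((f ^^ j) (est x0 z0 (k + (N - 1)))))"
    using descent_terms_vanish(2)[of x0 z0] unfolding optimal_cost_def cost_tendsto_0_iff by blast
  then have correction: "merging sequentially
      (\<lambda>k. h ((f ^^ j) (est x0 z0 (k + (N - 1)))))
      (\<lambda>k. h ((f ^^ j) (corrected x0 z0 (k + (N - 1)))))" if "j < N - 1" for j
    using that by (blast intro: merging_sym)
  fix j
  assume "j < N"
  then show "merging sequentially (\<lambda>k. h ((f ^^ j) (corrected x0 z0 (k + (N - 1)))))
      (\<lambda>k. h ((f ^^ j) ((f ^^ k) x0)))"
  proof (induction j)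
    case 0
    show ?case
      using descent_terms_vanish(1) by (simp add: l_tendsto_0_iff)
  next
    case (Suc j)
    then have "j < N - 1" "j < N"
      by auto
    then have "merging sequentially (\<lambda>k. h ((f ^^ j) (est x0 z0 (k + (N - 1)))))
        (\<lambda>k. h ((f ^^ j) ((f ^^ k) x0)))"
      using merging_trans[OF correction Suc.IH] by blast
    from merging_compose[OF this filterlim_Suc]
    have "merging sequentially (\<lambda>k. h ((f ^^ j) (f (corrected x0 z0 (k + (N - 1))))))
        (\<lambda>k. h ((f ^^ j) (f ((f ^^ k) x0))))"
      by (simp add: est_Suc del: est.simps)
    then show ?case
      by (simp add: funpow_Suc_right del: funpow.simps(2))
  qed
qed

theorem observer_converges:
  "(\<lambda>k. dist ((f ^^ (N - 1)) (est x0 z0 k)) ((f ^^ k) x0)) \<longlonglongrightarrow> 0"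
proof (rule LIMSEQ_offset)
  show "(\<lambda>k. dist ((f ^^ (N - 1)) (est x0 z0 (k + N))) ((f ^^ (k + N)) x0)) \<longlonglongrightarrow> 0"
    using prediction_merges[OF corrected_merges_with_plant] by (simp add: merging_def)
qed

section \<open>Stability\<close>

lemma lyapunov_initially_small:
  assumes init: "merging F (\<lambda>i. (f ^^ (N - 1)) (z0 i)) x0"
  shows "((\<lambda>i. lyapunov (x0 i) (z0 i) 0) \<longlongrightarrow> 0) F"
proof -
  have "merging F (\<lambda>i. est (x0 i) (z0 i) (N - 1)) x0"
    using merging_trans[OF est_merges_with_open_loop(1)[OF init] init] .
  then show ?thesis
    by (auto simp: lyapunov_def mismatch_tendsto_0_iff intro: merging_outputs)
qed

text \<open>
  Limits along \<open>top \<times>\<^sub>F F\<close> are limits along \<open>F\<close> that are uniform in time: the initial value of the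
  Lyapunov function bounds the mismatch at all later times.
\<close>

lemma observer_stable_along:
  assumes init: "merging F (\<lambda>i. (f ^^ (N - 1)) (z0 i)) x0" and "\<epsilon> > 0"
  shows "\<forall>\<^sub>F i in F. \<forall>k. dist ((f ^^ (N - 1)) (est (x0 i) (z0 i) k)) ((f ^^ k) (x0 i)) < \<epsilon>"
proof -
  let ?err = "\<lambda>k i. dist ((f ^^ (N - 1)) (est (x0 i) (z0 i) k)) ((f ^^ k) (x0 i))"
  have early: "\<forall>\<^sub>F i in F. \<forall>k\<in>{..<N}. ?err k i < \<epsilon>"
    using est_merges_with_open_loop(2)[OF init] \<open>\<epsilon> > 0\<close>
    by (intro eventually_ball_finite) (auto simp: merging_iff)
  have "((\<lambda>p. lyapunov (x0 (snd p)) (z0 (snd p)) 0) \<longlongrightarrow> 0) (top \<times>\<^sub>F F)"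
    by (rule filterlim_compose[OF lyapunov_initially_small[OF init] filterlim_snd])
  then have "((\<lambda>p. mismatch N (corrected (x0 (snd p)) (z0 (snd p)) (fst p + (N - 1)))
      ((f ^^ fst p) (x0 (snd p)))) \<longlongrightarrow> 0) (top \<times>\<^sub>F F)"
  proof (rule tendsto_0_le)
    fix p
    show "mismatch N (corrected (x0 (snd p)) (z0 (snd p)) (fst p + (N - 1)))
        ((f ^^ fst p) (x0 (snd p))) \<le> lyapunov (x0 (snd p)) (z0 (snd p)) 0"
      using corrected_mismatch_le[of "x0 (snd p)" "z0 (snd p)" "fst p"]
        optimal_cost_nonneg[of "x0 (snd p)" "z0 (snd p)" "fst p + (N - 1)"]
        decseqD[OF lyapunov_decreasing, of 0 "fst p" "x0 (snd p)" "z0 (snd p)"] by linarith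
  qed (rule mismatch_nonneg)
  then have "merging (top \<times>\<^sub>F F)
      (\<lambda>p. corrected (x0 (snd p)) (z0 (snd p)) (fst p + (N - 1)))
      (\<lambda>p. (f ^^ fst p) (x0 (snd p)))"
    unfolding mismatch_tendsto_0_iff by (blast intro: merging_by_observability)
  from prediction_merges[OF this] \<open>\<epsilon> > 0\<close>
  have "\<forall>\<^sub>F p in top \<times>\<^sub>F F. ?err (fst p + N) (snd p) < \<epsilon>"
    by (simp add: merging_iff)
  then have late: "\<forall>\<^sub>F i in F. \<forall>k. ?err (k + N) i < \<epsilon>"
    unfolding eventually_prod_filter by (auto elim!: eventually_mono)
  from early late show ?thesis
  proof eventually_elim
    case (elim i)
    show ?case
    proof
      fix k
      show "?err k i < \<epsilon>"
        using elim(1) elim(2)[rule_format, of "k - N"] by (cases "k < N") simp_all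
    qed
  qed
qed

theorem observer_stable:
  assumes "\<epsilon> > 0"
  shows "\<exists>\<delta>>0. \<forall>x0 z0. dist ((f ^^ (N - 1)) z0) x0 \<le> \<delta> \<longrightarrow>
    (\<forall>k. dist ((f ^^ (N - 1)) (est x0 z0 k)) ((f ^^ k) x0) < \<epsilon>)"
proof -
  \<comment> \<open>The coarsest filter on pairs of initial conditions along which the initial error vanishes
    turns the limit statement into one with a uniform threshold.\<close>
  define err where "err = (\<lambda>p. dist ((f ^^ (N - 1)) (snd p)) (fst p :: 'a))"
  have "merging (filtercomap err (nhds 0)) (\<lambda>p. (f ^^ (N - 1)) (snd p)) fst"
    unfolding merging_def err_def by (rule filterlim_filtercomap)
  from observer_stable_along[OF this assms]
  obtain d where "d > 0" and d: "\<And>p k. err p < d \<Longrightarrow>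
      dist ((f ^^ (N - 1)) (est (fst p) (snd p) k)) ((f ^^ k) (fst p)) < \<epsilon>"
    by (auto simp: eventually_filtercomap eventually_nhds_metric err_def)
  show ?thesis
  proof (intro exI[of _ "d / 2"] conjI allI impI)
    fix x0 z0 k
    assume "dist ((f ^^ (N - 1)) z0) x0 \<le> d / 2"
    then show "dist ((f ^^ (N - 1)) (est x0 z0 k)) ((f ^^ k) x0) < \<epsilon>"
      using d[of "(x0, z0)" k] \<open>d > 0\<close> by (simp add: err_def)
  qed (use \<open>d > 0\<close> in simp)
qed

end

section \<open>Stability and convergence of the observer runs\<close>

lemma arg_min_eqI:
  fixes c :: "'a \<Rightarrow> real"
  assumes "\<And>\<xi>. \<xi> \<noteq> m \<Longrightarrow> c m < c \<xi>"
  shows "(ARG_MIN c \<xi>. True) = m"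
  unfolding arg_min_def is_arg_min_def
  by (rule some_equality) (use assms less_asym in blast)+


theorem theorem4:
  fixes f :: "'a::complete_space \<Rightarrow> 'a"
    and h :: "'a \<Rightarrow> 'b::complete_space"
    and l :: "'b \<Rightarrow> 'b \<Rightarrow> real"
    and \<alpha>1 \<alpha>2 :: "real \<Rightarrow> real"
    and N :: nat
    and \<eta> :: "'a \<Rightarrow> 'b \<Rightarrow> 'a"
  assumes "finite_dimensional_space (euclidean :: 'a topology)"
    and "finite_dimensional_space (euclidean :: 'b topology)"
    and "uniformly_continuous_on UNIV f"
    and "uniformly_continuous_on UNIV h"
    and l_nonneg: "\<And>v w. 0 \<le> l v w"
    and l_sym: "\<And>v w. l v w = l w v"
    and "class_K_inf \<alpha>1" and "class_K_inf \<alpha>2"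
    and l_bounds: "\<And>v w. \<alpha>1 (dist v w) \<le> l v w \<and> l v w \<le> \<alpha>2 (dist v w)"
    and "1 \<le> N"
    and observability:
      "\<exists>\<alpha>3. class_K_inf \<alpha>3 \<and>
         (\<forall>z xt. (\<Sum>i<N. l (h ((f ^^ i) z)) (h ((f ^^ i) xt))) \<ge> \<alpha>3 (dist z xt))"
    and \<eta>_minimizer:
      "\<And>z y \<xi>. \<xi> \<noteq> \<eta> z y \<Longrightarrow> horizon_cost f h l N (\<eta> z y) z y < horizon_cost f h l N \<xi> z y"
    and \<eta>_decrease:
      "\<exists>\<alpha>4. class_K_inf \<alpha>4 \<and>
         (\<forall>z xt. let y = h ((f ^^ (N - 1)) xt); e = \<eta> z y in
            \<alpha>4 (horizon_cost f h l N e z y) + (\<Sum>i<N. l (h ((f ^^ i) e)) (h ((f ^^ i) xt)))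
              \<le> (\<Sum>i<N - 1. l (h ((f ^^ i) z)) (h ((f ^^ i) xt))))"
  shows
    "(\<forall>\<epsilon>>0. \<exists>\<delta>>0. \<forall>x y z xhat.
        system_run f h x y \<longrightarrow> observer_run f h l N y z xhat \<longrightarrow>
        dist (xhat 0) (x 0) \<le> \<delta> \<longrightarrow> (\<forall>k. dist (xhat k) (x k) \<le> \<epsilon>)) \<and>
     (\<forall>x y z xhat.
        system_run f h x y \<longrightarrow> observer_run f h l N y z xhat \<longrightarrow>
        (\<lambda>k. dist (xhat k) (x k)) \<longlonglongrightarrow> 0)"
proof -
  obtain \<alpha>3 where \<alpha>3: "class_K_inf \<alpha>3"
    "\<And>z xt. \<alpha>3 (dist z xt) \<le> (\<Sum>i<N. l (h ((f ^^ i) z)) (h ((f ^^ i) xt)))"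
    using observability by blast
  obtain \<alpha>4 where \<alpha>4: "class_K_inf \<alpha>4"
    "\<And>z xt. \<alpha>4 (horizon_cost f h l N (\<eta> z (h ((f ^^ (N - 1)) xt))) z (h ((f ^^ (N - 1)) xt)))
         + (\<Sum>i<N. l (h ((f ^^ i) (\<eta> z (h ((f ^^ (N - 1)) xt))))) (h ((f ^^ i) xt)))
       \<le> (\<Sum>i<N - 1. l (h ((f ^^ i) z)) (h ((f ^^ i) xt)))"
    using \<eta>_decrease unfolding Let_def by blast
  have minimal: "horizon_cost f h l N (\<eta> z y) z y \<le> horizon_cost f h l N \<xi> z y" for z y \<xi>
    using \<eta>_minimizer[of \<xi> z y] by (cases "\<xi> = \<eta> z y") auto
  interpret moving_horizon_observer f h l \<alpha>1 \<alpha>2 \<alpha>3 \<alpha>4 N \<eta>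
    using assms(3-5,7,8,10) l_bounds \<alpha>3 \<alpha>4 minimal by unfold_locales blast+
  have arg_min_eq: "(ARG_MIN (\<lambda>\<xi>. horizon_cost f h l N \<xi> z y) \<xi>. True) = \<eta> z y" for z y
    by (rule arg_min_eqI) (rule \<eta>_minimizer)
  have runs: "x k = (f ^^ k) (x 0) \<and> xhat k = (f ^^ (N - 1)) (est (x 0) (z 0) k)"
    if "system_run f h x y" "observer_run f h l N y z xhat" for x y z xhat k
  proof -
    have x: "x k = (f ^^ k) (x 0)" for k
      using that(1) by (induction k) (auto simp: system_run_def)
    have "z (Suc k) = f (\<eta> (z k) (h ((f ^^ k) (x 0))))" for k
      using that x[of k] by (simp add: system_run_def observer_run_def arg_min_eq)
    then have "z k = est (x 0) (z 0) k"
      by (induction k) auto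
    then show ?thesis
      using x[of k] that(2) by (simp add: observer_run_def)
  qed
  show ?thesis
  proof (intro conjI allI impI)
    fix \<epsilon> :: real
    assume "\<epsilon> > 0"
    then obtain \<delta> where "\<delta> > 0" and \<delta>: "\<And>x0 z0 k. dist ((f ^^ (N - 1)) z0) x0 \<le> \<delta> \<Longrightarrow>
        dist ((f ^^ (N - 1)) (est x0 z0 k)) ((f ^^ k) x0) < \<epsilon>"
      using observer_stable by meson
    show "\<exists>\<delta>>0. \<forall>x y z xhat. system_run f h x y \<longrightarrow> observer_run f h l N y z xhat \<longrightarrow>
        dist (xhat 0) (x 0) \<le> \<delta> \<longrightarrow> (\<forall>k. dist (xhat k) (x k) \<le> \<epsilon>)"
    proof (intro exI[of _ \<delta>] conjI allI impI)
      fix x y z xhat k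
      assume run: "system_run f h x y" "observer_run f h l N y z xhat"
        and "dist (xhat 0) (x 0) \<le> \<delta>"
      then have "dist ((f ^^ (N - 1)) (z 0)) (x 0) \<le> \<delta>"
        using runs[OF run, of 0] by simp
      from \<delta>[OF this, of k] show "dist (xhat k) (x k) \<le> \<epsilon>"
        using runs[OF run, of k] by simp
    qed (rule \<open>\<delta> > 0\<close>)
  next
    fix x y z xhat
    assume run: "system_run f h x y" "observer_run f h l N y z xhat"
    have "dist (xhat k) (x k) = dist ((f ^^ (N - 1)) (est (x 0) (z 0) k)) ((f ^^ k) (x 0))" for k
      using runs[OF run, of k] by simp
    then show "(\<lambda>k. dist (xhat k) (x k)) \<longlonglongrightarrow> 0"
      using observer_converges[of "x 0" "z 0"] by simp
  qed
qed

end
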